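(* Let $X$ be a locally compact Hausdorff space, let $\pi$ be a Borel probability measure on $X\times X$, and let $\Phi:X\times X\to\mathbb{R}$ be continuous with compact support. Let $\mu=\pi^1$ be the first marginal of $\pi$, let $\pi_\Phi$ be the finite signed measure $\pi_\Phi(A)=\iint_A\Phi\,d\pi$ ($A$ a Borel set in $X\times X$), and let $\pi^1_\Phi$ be the first marginal of $\pi_\Phi$. Then the Radon-Nikodym derivative $\psi=\frac{d\pi^1_\Phi}{d\mu}$ exists and satisfies $$\int_X \varphi(x)\psi(x)\,d\mu(x)=\iint_{X\times X}\varphi(x)\Phi(x,y)\,d\pi(x,y)$$ for every continuous compactly supported function $\varphi:X\to\mathbb{R}$.
   Context: For a finite (possibly signed) measure $\rho$ on the Borel sets of $X\times X$, its first marginal is the measure $\rho^1(B)=\rho(B\times X)$, $B$ a Borel set in $X$. *)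

theory Defs
  imports "HOL-Analysis.Analysis" "HOL-Probability.Probability_Measure"
begin

definition compact_support :: "('a::topological_space \<Rightarrow> real) \<Rightarrow> bool" where
  "compact_support f \<longleftrightarrow> compact (closure (support_on UNIV f))"

text \<open>A finite signed measure on the sigma-algebra of \<open>M\<close> is represented by a real-valued set
  function; its values outside \<^term>\<open>sets M\<close> are irrelevant.  The measure carried by \<open>M\<close> itself
  plays no role.\<close>

definition finite_signed_measure :: "'a measure \<Rightarrow> ('a set \<Rightarrow> real) \<Rightarrow> bool" where
  "finite_signed_measure M \<nu> \<longleftrightarrow> \<nu> {} = 0 \<and>
     (\<forall>A :: nat \<Rightarrow> 'a set. range A \<subseteq> sets M \<longrightarrow> disjoint_family A \<longrightarrow>
        (\<lambda>i. \<nu> (A i)) sums \<nu> (\<Union>i. A i))"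

definition signed_density :: "'a measure \<Rightarrow> ('a \<Rightarrow> real) \<Rightarrow> 'a set \<Rightarrow> real" where
  "signed_density M f A = (LINT z:A|M. f z)"

text \<open>The first marginal, once for positive measures (as a push-forward under the projection) and
  once for signed measures; \<open>emeasure_first_marginal\<close> and \<open>measure_first_marginal\<close> below show that
  both are given by \<open>B \<mapsto> \<rho>(B \<times> X)\<close>.\<close>

definition first_marginal :: "('a::topological_space \<times> 'b::topological_space) measure \<Rightarrow> 'a measure" where
  "first_marginal \<rho> = distr \<rho> borel fst"

definition signed_first_marginal :: "(('a \<times> 'b) set \<Rightarrow> real) \<Rightarrow> 'a set \<Rightarrow> real" where
  "signed_first_marginal \<rho> B = \<rho> (B \<times> UNIV)"

text \<open>\<open>\<psi>\<close> is a version of the Radon-Nikodym derivative \<open>d\<nu>/d\<mu>\<close> of a finite signed measure \<open>\<nu>\<close>.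
  The library's \<^const>\<open>RN_deriv\<close> only covers positive \<open>\<nu>\<close>.\<close>

definition is_signed_RN_deriv :: "'a measure \<Rightarrow> ('a set \<Rightarrow> real) \<Rightarrow> ('a \<Rightarrow> real) \<Rightarrow> bool" where
  "is_signed_RN_deriv \<mu> \<nu> \<psi> \<longleftrightarrow>
     integrable \<mu> \<psi> \<and> (\<forall>B\<in>sets \<mu>. \<nu> B = (LINT x:B|\<mu>. \<psi> x))"

lemma fst_borel_measurable:
  fixes \<rho> :: "('a::topological_space \<times> 'b::topological_space) measure"
  assumes "sets \<rho> = sets borel"
  shows "fst \<in> borel_measurable \<rho>"
proof -
  have "(fst :: 'a \<times> 'b \<Rightarrow> 'a) \<in> borel_measurable borel"
    by (intro borel_measurable_continuous_onI continuous_on_fst continuous_on_id)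
  then show ?thesis
    by (simp add: measurable_cong_sets[OF assms refl])
qed

lemma fst_vimage_borel:
  fixes \<rho> :: "('a::topological_space \<times> 'b::topological_space) measure"
  assumes "sets \<rho> = sets borel"
  shows "fst -` B \<inter> space \<rho> = B \<times> UNIV"
proof -
  have "space \<rho> = UNIV"
    using sets_eq_imp_space_eq[OF assms] by simp
  then show ?thesis by auto
qed

lemma emeasure_first_marginal:
  assumes "sets \<rho> = sets borel" "B \<in> sets borel"
  shows "emeasure (first_marginal \<rho>) B = emeasure \<rho> (B \<times> UNIV)"
  unfolding first_marginal_def
  by (simp add: emeasure_distr fst_borel_measurable assms fst_vimage_borel)

lemma measure_first_marginal:
  assumes "sets \<rho> = sets borel" "B \<in> sets borel"
  shows "measure (first_marginal \<rho>) B = signed_first_marginal (measure \<rho>) B"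
  using emeasure_first_marginal[OF assms] by (simp add: measure_def signed_first_marginal_def)

lemma finite_signed_measure_signed_density:
  assumes f: "integrable M f"
  shows "finite_signed_measure M (signed_density M f)"
  unfolding finite_signed_measure_def
proof (intro conjI allI impI)
  show "signed_density M f {} = 0"
    by (simp add: signed_density_def set_lebesgue_integral_def)
next
  fix A :: "nat \<Rightarrow> 'a set"
  assume A: "range A \<subseteq> sets M" and disj: "disjoint_family A"
  have S: "set_integrable M B f" if "B \<in> sets M" for B
    using f that unfolding set_integrable_def by (rule integrable_mult_indicator[rotated])
  have U: "(\<Union>i<n. A i) \<in> sets M" "(\<Union>i. A i) \<in> sets M" for n :: nat
    using A by auto
  have lim: "(\<lambda>n. LINT x:(\<Union>i<n. A i)|M. f x) \<longlonglongrightarrow> (LINT x:(\<Union>n. \<Union>i<n. A i)|M. f x)"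
  proof (rule set_integral_cont_up)
    show "incseq (\<lambda>n. \<Union>i<n. A i)"
      by (intro monoI UN_mono) auto
    have "(\<Union>n. \<Union>i<n. A i) = (\<Union>i. A i)" by auto
    then show "set_integrable M (\<Union>n. \<Union>i<n. A i) f"
      using S[OF U(2)] by metis
  qed (rule U)
  have union: "(\<Union>n. \<Union>i<n. A i) = (\<Union>i. A i)" by auto
  have sum: "(LINT x:(\<Union>i<n. A i)|M. f x) = (\<Sum>i<n. LINT x:A i|M. f x)" for n
  proof (rule set_integral_finite_Union)
    show "disjoint_family_on A {..<n}"
      using disj by (auto simp: disjoint_family_on_def)
  qed (use A in \<open>auto intro: S\<close>)
  have "(\<lambda>n. \<Sum>i<n. LINT x:A i|M. f x) \<longlonglongrightarrow> (LINT x:(\<Union>i. A i)|M. f x)"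
    using lim unfolding union sum .
  then show "(\<lambda>i. signed_density M f (A i)) sums signed_density M f (\<Union>i. A i)"
    unfolding sums_def signed_density_def .
qed

lemma finite_signed_measure_signed_first_marginal:
  fixes \<rho> :: "('a::topological_space \<times> 'b::topological_space) set \<Rightarrow> real"
  assumes "finite_signed_measure borel \<rho>"
  shows "finite_signed_measure borel (signed_first_marginal \<rho>)"
  unfolding finite_signed_measure_def
proof (intro conjI allI impI)
  show "signed_first_marginal \<rho> {} = 0"
    using assms by (simp add: finite_signed_measure_def signed_first_marginal_def)
next
  fix A :: "nat \<Rightarrow> 'a set"
  assume A: "range A \<subseteq> sets borel" and disj: "disjoint_family A"
  have "B \<times> (UNIV :: 'b set) \<in> sets borel" if "B \<in> sets borel" for B :: "'a set"
    using measurable_sets[OF fst_borel_measurable[of "borel :: ('a \<times> 'b) measure", OF refl] that]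
      fst_vimage_borel[of "borel :: ('a \<times> 'b) measure" B] by simp
  then have "range (\<lambda>i. A i \<times> (UNIV :: 'b set)) \<subseteq> sets borel"
    using A by blast
  moreover have "disjoint_family (\<lambda>i. A i \<times> (UNIV :: 'b set))"
    using disj by (auto simp: disjoint_family_on_def)
  ultimately have "(\<lambda>i. \<rho> (A i \<times> UNIV)) sums \<rho> (\<Union>i. A i \<times> UNIV)"
    using assms unfolding finite_signed_measure_def by simp
  moreover have "(\<Union>i. A i \<times> UNIV) = (\<Union>i. A i) \<times> (UNIV :: 'b set)" by auto
  ultimately show "(\<lambda>i. signed_first_marginal \<rho> (A i)) sums signed_first_marginal \<rho> (\<Union>i. A i)"
    by (simp add: signed_first_marginal_def)
qed

lemma integrable_compact_support:
  fixes f :: "'a::topological_space \<Rightarrow> real"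
  assumes "finite_measure M" "sets M = sets borel" "continuous_on UNIV f" "compact_support f"
  shows "integrable M f"
proof -
  have "compact (f ` closure (support_on UNIV f))"
    using assms by (intro compact_continuous_image)
      (auto simp: compact_support_def intro: continuous_on_subset)
  then obtain K where K: "\<And>x. x \<in> closure (support_on UNIV f) \<Longrightarrow> norm (f x) \<le> K"
    by (meson bounded_iff compact_imp_bounded imageI)
  have "norm (f x) \<le> max K 0" for x
  proof (cases "f x = 0")
    case False
    then have "x \<in> closure (support_on UNIV f)"
      using closure_subset by (fastforce simp: support_on_def)
    then show ?thesis using K[of x] by linarith
  qed simp
  moreover have "f \<in> borel_measurable M"
    using borel_measurable_continuous_onI[OF assms(3)]
    by (simp add: measurable_cong_sets[OF assms(2) refl])
  ultimately show ?thesis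
    by (intro finite_measure.integrable_const_bound[OF assms(1), of _ "max K 0"] AE_I2)
qed

end

theory Submission
  imports Defs
begin

text \<open>The Radon-Nikodym theorem, applied to the marginals of the positive and the negative part of
  \<open>\<pi>\<^sub>\<Phi>\<close>, yields a density that satisfies the integral identity against every bounded Borel
  function. Its instances for indicator functions say that this density is \<open>d\<pi>\<^sup>1\<^sub>\<Phi>/d\<mu>\<close>; any other
  version agrees with it almost everywhere.\<close>

lemma compact_support_bounded:
  fixes f :: "'a::topological_space \<Rightarrow> real"
  assumes "continuous_on UNIV f" "compact_support f"
  obtains K where "\<And>x. \<bar>f x\<bar> \<le> K"
proof -
  have "compact (f ` closure (support_on UNIV f))"
    using assms by (intro compact_continuous_image)
      (auto simp: compact_support_def intro: continuous_on_subset)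
  then obtain K where K: "\<And>x. x \<in> closure (support_on UNIV f) \<Longrightarrow> \<bar>f x\<bar> \<le> K"
    by (metis bounded_iff compact_imp_bounded imageI real_norm_def)
  \<comment> \<open>If the support is empty, nothing constrains \<open>K\<close>, which may then be
    negative; hence the maximum with 0.\<close>
  have "\<bar>f x\<bar> \<le> max K 0" for x
  proof (cases "f x = 0")
    case False
    then have "x \<in> closure (support_on UNIV f)"
      using closure_subset by (fastforce simp: support_on_def)
    then show ?thesis using K[of x] by linarith
  qed simp
  then show thesis by (rule that)
qed

lemma integrable_bounded_mult:
  fixes f h :: "'a \<Rightarrow> real"
  assumes f: "integrable M f" and h: "h \<in> borel_measurable M" and K: "\<And>x. \<bar>h x\<bar> \<le> K"
  shows "integrable M (\<lambda>x. h x * f x)"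
proof (rule Bochner_Integration.integrable_bound)
  show "integrable M (\<lambda>x. K * f x)"
    using f by simp
  show "(\<lambda>x. h x * f x) \<in> borel_measurable M"
    using f h by measurable
  show "AE x in M. norm (h x * f x) \<le> norm (K * f x)"
    using K by (intro AE_I2) (auto simp: abs_mult intro!: mult_right_mono order_trans[OF K])
qed

text \<open>Preimages under \<open>g\<close> of sets that are null for the push-forward of
  \<open>M\<close> are null for \<open>M\<close>, hence for \<open>density M f\<close>. So the
  push-forward of \<open>density M f\<close> is absolutely continuous, and Radon-Nikodym gives
  \<open>D\<close>.\<close>

lemma (in finite_measure) distr_density_nonneg:
  fixes f :: "'a \<Rightarrow> real"
  assumes f: "integrable M f" and nonneg: "\<And>x. 0 \<le> f x" and g[measurable]: "g \<in> measurable M N"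
  obtains D :: "'b \<Rightarrow> real" where "D \<in> borel_measurable N" "\<And>y. 0 \<le> D y"
    "density (distr M N g) D = distr (density M f) N g"
proof -
  let ?\<mu> = "distr M N g" and ?\<nu> = "distr (density M f) N g"
  have f_meas[measurable]: "f \<in> borel_measurable M"
    using f by simp
  interpret \<mu>: finite_measure ?\<mu>
    using g by (rule finite_measure_distr)
  have "emeasure (density M f) (space M) < \<infinity>"
    using f nonneg by (simp add: emeasure_density nn_integral_eq_integral cong: nn_integral_cong)
  then have "finite_measure (density M f)"
    by (intro finite_measureI) (simp add: less_top)
  then have fin: "finite_measure ?\<nu>"
    by (rule finite_measure.finite_measure_distr) simp
  have ac: "absolutely_continuous ?\<mu> ?\<nu>"
    unfolding absolutely_continuous_def
  proof
    fix B assume "B \<in> null_sets ?\<mu>"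
    then have B: "B \<in> sets N" and "g -` B \<inter> space M \<in> null_sets M"
      by (auto simp: null_sets_distr_iff)
    then have "g -` B \<inter> space M \<in> null_sets (density M f)"
      using absolutely_continuousI_density[of "\<lambda>x. ennreal (f x)" M]
      by (auto simp: absolutely_continuous_def)
    then show "B \<in> null_sets ?\<nu>"
      using B by (simp add: null_sets_distr_iff)
  qed
  \<comment> \<open>Finiteness of both push-forwards makes the extended-valued derivative finite
    almost everywhere, so a real nonnegative version exists.\<close>
  obtain D where D: "D \<in> borel_measurable ?\<mu>" "AE y in ?\<mu>. RN_deriv ?\<mu> ?\<nu> y = ennreal (D y)"
      "\<And>y. 0 \<le> D y"
    using \<mu>.real_RN_deriv[OF fin ac] by auto
  have "density ?\<mu> D = density ?\<mu> (RN_deriv ?\<mu> ?\<nu>)"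
    using D by (intro density_cong) auto
  also have "\<dots> = ?\<nu>"
    using ac by (rule \<mu>.density_RN_deriv) simp
  finally show thesis
    using D that by simp
qed

text \<open>The two descriptions of the pushed-forward measure, as a density and as an image, turn
  one integral of \<open>h\<close> into the two sides. Measurability of \<open>h\<close> suffices:
  if one side is not integrable, neither is the other, and both integrals take the default value
  0.\<close>

lemma (in finite_measure) marginal_density_nonneg:
  fixes f :: "'a \<Rightarrow> real"
  assumes f: "integrable M f" and nonneg: "\<And>x. 0 \<le> f x" and g[measurable]: "g \<in> measurable M N"
  obtains D :: "'b \<Rightarrow> real" where "integrable (distr M N g) D"
    "\<And>h. h \<in> borel_measurable N \<Longrightarrow> (LINT y|distr M N g. h y * D y) = (LINT x|M. h (g x) * f x)"
proof -
  obtain D :: "'b \<Rightarrow> real" where D[measurable]: "D \<in> borel_measurable N" and D0: "\<And>y. 0 \<le> D y"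
    and eq: "density (distr M N g) D = distr (density M f) N g"
    by (rule distr_density_nonneg[OF assms]) blast
  have f_meas[measurable]: "f \<in> borel_measurable M"
    using f by simp
  \<comment> \<open>Integrability of the constant 1 expresses finite total mass; read through the
    density, it is integrability of \<open>D\<close>.\<close>
  have "integrable (density (distr M N g) D) (\<lambda>_. 1::real)"
    unfolding eq using f nonneg by (simp add: integrable_distr_eq integrable_density)
  then have "integrable (distr M N g) D"
    using D0 by (simp add: integrable_density)
  moreover have "(LINT y|distr M N g. h y * D y) = (LINT x|M. h (g x) * f x)"
    if h[measurable]: "h \<in> borel_measurable N" for h
  proof -
    have "(LINT y|distr M N g. h y * D y) = (LINT y|density (distr M N g) D. h y)"
      using D0 by (simp add: integral_density mult.commute)
    also have "\<dots> = (LINT x|density M f. h (g x))"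
      unfolding eq by (simp add: integral_distr)
    also have "\<dots> = (LINT x|M. h (g x) * f x)"
      using nonneg by (simp add: integral_density mult.commute)
    finally show ?thesis .
  qed
  ultimately show thesis
    using that by blast
qed

text \<open>The density is the difference of those belonging to the positive and negative parts of
  \<open>f\<close>. The bound on \<open>h\<close> enters because splitting the integral of a
  difference requires both pieces to be integrable.\<close>

lemma (in finite_measure) marginal_density:
  fixes f :: "'a \<Rightarrow> real"
  assumes f: "integrable M f" and g[measurable]: "g \<in> measurable M N"
  obtains D :: "'b \<Rightarrow> real" where "integrable (distr M N g) D"
    "\<And>h K. h \<in> borel_measurable N \<Longrightarrow> (\<And>y. \<bar>h y\<bar> \<le> K) \<Longrightarrow>
      (LINT y|distr M N g. h y * D y) = (LINT x|M. h (g x) * f x)"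
proof -
  let ?\<mu> = "distr M N g" and ?p = "\<lambda>x. max 0 (f x)" and ?n = "\<lambda>x. max 0 (- f x)"
  have pn: "integrable M ?p" "integrable M ?n"
    using f by auto
  obtain P where P: "integrable ?\<mu> P" "\<And>h. h \<in> borel_measurable N \<Longrightarrow>
      (LINT y|?\<mu>. h y * P y) = (LINT x|M. h (g x) * ?p x)"
    using marginal_density_nonneg[OF pn(1) _ g] by auto
  obtain Q where Q: "integrable ?\<mu> Q" "\<And>h. h \<in> borel_measurable N \<Longrightarrow>
      (LINT y|?\<mu>. h y * Q y) = (LINT x|M. h (g x) * ?n x)"
    using marginal_density_nonneg[OF pn(2) _ g] by auto
  have "(LINT y|?\<mu>. h y * (P y - Q y)) = (LINT x|M. h (g x) * f x)"
    if h[measurable]: "h \<in> borel_measurable N" and K: "\<And>y. \<bar>h y\<bar> \<le> K" for h K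
  proof -
    have "(LINT y|?\<mu>. h y * (P y - Q y)) = (LINT y|?\<mu>. h y * P y) - (LINT y|?\<mu>. h y * Q y)"
      unfolding right_diff_distrib using P(1) Q(1) K
      by (intro Bochner_Integration.integral_diff integrable_bounded_mult) auto
    also have "\<dots> = (LINT x|M. h (g x) * ?p x) - (LINT x|M. h (g x) * ?n x)"
      using P(2)[OF h] Q(2)[OF h] by simp
    also have "\<dots> = (LINT x|M. h (g x) * ?p x - h (g x) * ?n x)"
      using pn K
      by (intro Bochner_Integration.integral_diff[symmetric] integrable_bounded_mult) auto
    also have "\<dots> = (LINT x|M. h (g x) * f x)"
      by (intro Bochner_Integration.integral_cong) (auto simp: max_def)
    finally show ?thesis .
  qed
  moreover have "integrable ?\<mu> (\<lambda>y. P y - Q y)"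
    using P(1) Q(1) by simp
  ultimately show thesis
    using that by blast
qed

theorem theorem1p3:
  fixes \<pi> :: "('a::t2_space \<times> 'a) measure"
    and \<Phi> :: "'a \<times> 'a \<Rightarrow> real"
  assumes "locally_compact_space (euclidean :: 'a topology)"
    and "prob_space \<pi>" and "sets \<pi> = sets borel"
    and "continuous_on UNIV \<Phi>" and "compact_support \<Phi>"
  shows "(\<exists>\<psi>. is_signed_RN_deriv (first_marginal \<pi>)
                 (signed_first_marginal (signed_density \<pi> \<Phi>)) \<psi>) \<and>
    (\<forall>\<psi>. is_signed_RN_deriv (first_marginal \<pi>)
             (signed_first_marginal (signed_density \<pi> \<Phi>)) \<psi> \<longrightarrow>
      (\<forall>\<phi> :: 'a \<Rightarrow> real. continuous_on UNIV \<phi> \<longrightarrow> compact_support \<phi> \<longrightarrow>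
         integrable (first_marginal \<pi>) (\<lambda>x. \<phi> x * \<psi> x) \<and>
         integrable \<pi> (\<lambda>(x, y). \<phi> x * \<Phi> (x, y)) \<and>
         (LINT x|first_marginal \<pi>. \<phi> x * \<psi> x) = (LINT (x, y)|\<pi>. \<phi> x * \<Phi> (x, y))))"
proof -
  let ?\<mu> = "first_marginal \<pi>"
  let ?\<nu> = "signed_first_marginal (signed_density \<pi> \<Phi>)"
  interpret prob_space \<pi> by fact
  have fst_meas[measurable]: "fst \<in> measurable \<pi> borel"
    using assms(3) by (rule fst_borel_measurable)
  have \<Phi>: "integrable \<pi> \<Phi>"
    using finite_measure_axioms assms(3-5) by (rule integrable_compact_support)
  obtain D where D: "integrable ?\<mu> D"
    and D_eq: "\<And>h K. h \<in> borel_measurable borel \<Longrightarrow> (\<And>x. \<bar>h x\<bar> \<le> K) \<Longrightarrow>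
      (LINT x|?\<mu>. h x * D x) = (LINT z|\<pi>. h (fst z) * \<Phi> z)"
    unfolding first_marginal_def by (rule marginal_density[OF \<Phi> fst_meas]) blast
  have sets_\<mu>: "sets ?\<mu> = sets borel"
    by (simp add: first_marginal_def)
  have RN_D: "is_signed_RN_deriv ?\<mu> ?\<nu> D"
    unfolding is_signed_RN_deriv_def
  proof (intro conjI ballI)
    fix B assume "B \<in> sets ?\<mu>"
    then have "(indicator B :: 'a \<Rightarrow> real) \<in> borel_measurable borel"
      by (simp add: sets_\<mu>)
    then have "(LINT x|?\<mu>. indicator B x * D x) = (LINT z|\<pi>. indicator B (fst z) * \<Phi> z)"
      by (rule D_eq[of _ 1]) (simp add: indicator_def)
    \<comment> \<open>The function \<open>indicator B (fst z)\<close> is the indicator of the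
      cylinder \<open>B \<times> UNIV\<close>, on which the marginal evaluates the signed
      measure.\<close>
    then show "?\<nu> B = (LINT x:B|?\<mu>. D x)"
      by (simp add: signed_first_marginal_def signed_density_def set_lebesgue_integral_def
          indicator_times)
  qed (rule D)
  moreover have "integrable ?\<mu> (\<lambda>x. \<phi> x * \<psi> x) \<and> integrable \<pi> (\<lambda>(x, y). \<phi> x * \<Phi> (x, y)) \<and>
      (LINT x|?\<mu>. \<phi> x * \<psi> x) = (LINT (x, y)|\<pi>. \<phi> x * \<Phi> (x, y))"
    if \<psi>: "is_signed_RN_deriv ?\<mu> ?\<nu> \<psi>" and \<phi>: "continuous_on UNIV \<phi>" "compact_support \<phi>"
    for \<psi> \<phi>
  proof (intro conjI)
    obtain K where K: "\<And>x. \<bar>\<phi> x\<bar> \<le> K"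
      using compact_support_bounded[OF \<phi>] by blast
    have \<phi>_meas[measurable]: "\<phi> \<in> borel_measurable borel"
      using \<phi>(1) by (rule borel_measurable_continuous_onI)
    then have \<phi>_\<mu>: "\<phi> \<in> borel_measurable ?\<mu>"
      by (simp add: first_marginal_def)
    have \<psi>_int: "integrable ?\<mu> \<psi>"
      using \<psi> by (simp add: is_signed_RN_deriv_def)
    show "integrable ?\<mu> (\<lambda>x. \<phi> x * \<psi> x)"
      using \<psi>_int \<phi>_\<mu> K by (rule integrable_bounded_mult)
    \<comment> \<open>As a function on the product, \<open>\<phi> (fst z)\<close> is constant in the
      second coordinate and need not have compact support, but it is still bounded by
      \<open>K\<close>.\<close>
    show "integrable \<pi> (\<lambda>(x, y). \<phi> x * \<Phi> (x, y))"
      using integrable_bounded_mult[OF \<Phi>, of "\<lambda>z. \<phi> (fst z)" K] K by (simp add: case_prod_unfold)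
    \<comment> \<open>Both functions are integrable and have integral \<open>?\<nu> B\<close> over
      every measurable \<open>B\<close>, which determines them up to a null set.\<close>
    have "AE x in ?\<mu>. \<psi> x = D x"
      using \<psi>_int D by (rule density_unique_real) (use \<psi> RN_D in \<open>simp add: is_signed_RN_deriv_def\<close>)
    then have "(LINT x|?\<mu>. \<phi> x * \<psi> x) = (LINT x|?\<mu>. \<phi> x * D x)"
      using \<psi>_int D \<phi>_\<mu> by (intro integral_cong_AE) auto
    then show "(LINT x|?\<mu>. \<phi> x * \<psi> x) = (LINT (x, y)|\<pi>. \<phi> x * \<Phi> (x, y))"
      using D_eq[OF \<phi>_meas K] by (simp add: case_prod_unfold)
  qed
  ultimately show ?thesis
    by blast
qed

end
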